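(* Let $n\in\mathbb{N}$ with $n>1$. Let $p\in E(K(\beta\mathbb{N},+))$ and let $q\in\beta\mathbb{N}$ be such that for every $N\in\mathbb{N}$, every member of $q$ contains an $IP_N$ set. Let $A\in p\star_n q$, let $F_1$ be a nonempty finite subset of $\mathbb{P}$, and let $\Phi=(f_m:m\geq 2)$ be a sequence of functions $f_m:\mathbb{N}\to\mathbb{N}$. For $m\geq 2$ and $x\in\mathbb{N}$ let $F_{m,x}=\{P\in\mathbb{P}:\deg(P)\leq f_m(x)\text{ and }\mathrm{coef}(P)\leq f_m(x)\}$. Then there is a sequence $(x_k)_{k\in\mathbb{N}}$ in $\mathbb{N}$ such that \[\Big\{x_k\cdot n^{\sum_{i=1}^{k-1}p_i(x_i)}: k\in\mathbb{N},\ p_1\in F_1,\ \text{and } p_i\in F_{i,f_i(x_{i-1})}\text{ for }2\leq i\leq k-1\Big\}\subseteq A.\]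
   Context: $\beta\mathbb{N}$ is the set of ultrafilters on $\mathbb{N}$ (Stone–Čech compactification), with the extended addition: $B\in p+r$ iff $\{x:\{y:x+y\in B\}\in r\}\in p$. $K(\beta\mathbb{N},+)$ is the smallest two-sided ideal of $(\beta\mathbb{N},+)$ (the union of all minimal left ideals) and $E(T)$ denotes the set of idempotents in $T$. For $p,q\in\beta\mathbb{N}$, $p\star_n q$ is the ultrafilter defined by $B\in p\star_n q$ iff $\{a\in\mathbb{N}:\{b\in\mathbb{N}:n^a b\in B\}\in q\}\in p$ (the image of the tensor product $p\otimes q$ under $(a,b)\mapsto n^a b$). For $N\in\mathbb{N}$, an $IP_N$ set is a set of the form $\{\sum_{t\in H}b_t:\emptyset\neq H\subseteq\{1,\dots,N\}\}$ for some $b_1,\dots,b_N\in\mathbb{N}$. $\mathbb{P}$ is the set of polynomials with integer coefficients and zero constant term; for $P\in\mathbb{P}$, $\deg(P)$ is its degree and $\mathrm{coef}(P)$ is the maximum absolute value of its coefficients. *)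

theory Defs
  imports Complex_Main "HOL-Computational_Algebra.Polynomial"
begin

text \<open>
  Throughout, the natural numbers of the mathematical text are the positive integers.  Ultrafilters
  are represented by HOL filters: a set \<open>B\<close> is a member of \<open>p\<close> iff \<open>eventually (\<lambda>x. x \<in> B) p\<close>.
\<close>

definition ultrafilter :: "'a filter \<Rightarrow> bool" where
  "ultrafilter p \<longleftrightarrow> p \<noteq> bot \<and> (\<forall>P. eventually P p \<or> eventually (\<lambda>x. \<not> P x) p)"

text \<open>
  An ultrafilter on the positive integers is an ultrafilter on type \<open>nat\<close> that contains the set of
  positive integers, i.e. that is not the principal ultrafilter at \<open>0\<close>.
\<close>

definition betaN :: "nat filter set" where
  "betaN = {p. ultrafilter p \<and> eventually (\<lambda>x. x > 0) p}"

text \<open>Not \<open>prod_filter\<close>, which in general is not an ultrafilter even if both factors are.\<close>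

definition tensor :: "'a filter \<Rightarrow> 'b filter \<Rightarrow> ('a \<times> 'b) filter"  (infixr \<open>\<otimes>\<^sub>u\<close> 80) where
  "p \<otimes>\<^sub>u q = Abs_filter (\<lambda>P. eventually (\<lambda>x. eventually (\<lambda>y. P (x, y)) q) p)"

lemma eventually_tensor:
  "eventually P (p \<otimes>\<^sub>u q) \<longleftrightarrow> eventually (\<lambda>x. eventually (\<lambda>y. P (x, y)) q) p"
proof -
  have "is_filter (\<lambda>P. eventually (\<lambda>x. eventually (\<lambda>y. P (x, y)) q) p)"
    by (rule is_filter.intro) (auto elim!: eventually_mono simp: eventually_conj_iff)
  then show ?thesis
    unfolding tensor_def by (rule eventually_Abs_filter)
qed

definition beta_add :: "nat filter \<Rightarrow> nat filter \<Rightarrow> nat filter"  (infixl \<open>+\<^sub>\<beta>\<close> 65) where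
  "p +\<^sub>\<beta> r = filtermap (\<lambda>(x, y). x + y) (p \<otimes>\<^sub>u r)"

definition star :: "nat \<Rightarrow> nat filter \<Rightarrow> nat filter \<Rightarrow> nat filter" where
  "star n p q = filtermap (\<lambda>(a, b). n ^ a * b) (p \<otimes>\<^sub>u q)"

lemma eventually_beta_add:
  "eventually P (p +\<^sub>\<beta> r) \<longleftrightarrow> eventually (\<lambda>x. eventually (\<lambda>y. P (x + y)) r) p"
  by (simp add: beta_add_def eventually_filtermap eventually_tensor)

lemma eventually_star:
  "eventually P (star n p q) \<longleftrightarrow> eventually (\<lambda>a. eventually (\<lambda>b. P (n ^ a * b)) q) p"
  by (simp add: star_def eventually_filtermap eventually_tensor)

definition two_sided_ideal :: "nat filter set \<Rightarrow> bool" where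
  "two_sided_ideal I \<longleftrightarrow>
     I \<noteq> {} \<and> I \<subseteq> betaN \<and> (\<forall>u\<in>I. \<forall>p\<in>betaN. p +\<^sub>\<beta> u \<in> I \<and> u +\<^sub>\<beta> p \<in> I)"

text \<open>
  The smallest two-sided ideal: by the structure theory of compact right topological semigroups the
  intersection is nonempty, hence itself a two-sided ideal, and it is the union of all minimal left
  ideals.
\<close>

definition K_betaN :: "nat filter set" where
  "K_betaN = \<Inter> {I. two_sided_ideal I}"

definition idempotents :: "nat filter set \<Rightarrow> nat filter set" where
  "idempotents T = {p \<in> T. p +\<^sub>\<beta> p = p}"

definition IP_set :: "nat \<Rightarrow> nat set \<Rightarrow> bool" where
  "IP_set N S \<longleftrightarrow>
     (\<exists>b :: nat \<Rightarrow> nat. (\<forall>t\<in>{1..N}. b t > 0) \<and> S = {\<Sum>t\<in>H. b t | H. H \<noteq> {} \<and> H \<subseteq> {1..N}})"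

definition int_polys0 :: "int poly set" where
  "int_polys0 = {P. coeff P 0 = 0}"

definition max_coef :: "int poly \<Rightarrow> int" where
  "max_coef P = Max ((\<lambda>i. \<bar>coeff P i\<bar>) ` {..degree P})"

text \<open>\<open>poly_class f m x\<close> is the set \<open>F\<^bsub>m,x\<^esub>\<close> determined by the sequence \<open>f = (f\<^sub>m)\<close>.\<close>

definition poly_class :: "(nat \<Rightarrow> nat \<Rightarrow> nat) \<Rightarrow> nat \<Rightarrow> nat \<Rightarrow> int poly set" where
  "poly_class f m x =
     {P \<in> int_polys0. degree P \<le> f m x \<and> max_coef P \<le> int (f m x)}"

end

theory Submission
  imports Defs "HOL-Library.Function_Algebras" "HOL-Library.Multiset" "HOL-Library.FuncSet"
begin

text \<open>
  Let \<open>T\<close> be the set of exponents \<open>a\<close> with \<open>{b. n ^ a * b \<in> A} \<in> q\<close>.  It belongs to \<open>p\<close>, hence is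
  piecewise syndetic.  The terms \<open>x\<^sub>k = n ^ a * b\<close> are chosen greedily.  If \<open>S\<close> is the finite set of
  all exponents \<open>p\<^sub>1(x\<^sub>1) + \<dots> + p\<^bsub>k-1\<^esub>(x\<^bsub>k-1\<^esub>)\<close> realised so far, the invariant is that
  \<open>{a. \<forall>s\<in>S. a + s \<in> T}\<close> is piecewise syndetic.  Fixing such an \<open>a\<close>, the set of \<open>b\<close> with
  \<open>n ^ (a + s) * b \<in> A\<close> for all \<open>s \<in> S\<close> is a member of \<open>q\<close>, and the polynomial van der Waerden theorem
  for \<open>IP\<^sub>N\<close> sets, applied to the polynomials \<open>P(n ^ a * b)\<close> in \<open>b\<close>, provides a \<open>b\<close> in that set which
  preserves the invariant.

  Here \<open>N\<close> must not depend on the generators of the \<open>IP\<^sub>N\<close> set.  Colour focusing alone only gives an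
  \<open>N\<close> that does, but it works in arbitrary abelian groups; uniformity follows by running it with
  the universal generators, the coordinate functions in \<open>(nat \<Rightarrow> int) \<Rightarrow> int\<close>.
\<close>

section \<open>Polynomial van der Waerden theorem in abelian groups\<close>

text \<open>Maps vanishing at \<open>0\<close> that are polynomial of degree at most \<open>d\<close> in the finite-difference sense.\<close>

primrec polymap :: "nat \<Rightarrow> ('a::ab_group_add \<Rightarrow> 'b::ab_group_add) \<Rightarrow> bool" where
  "polymap 0 \<phi> \<longleftrightarrow> (\<forall>x. \<phi> x = 0)"
| "polymap (Suc d) \<phi> \<longleftrightarrow> \<phi> 0 = 0 \<and> (\<forall>D. polymap d (\<lambda>x. \<phi> (x + D) - \<phi> x - \<phi> D))"

lemma polymap_Suc: "polymap d \<phi> \<Longrightarrow> polymap (Suc d) \<phi>"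
proof (induction d arbitrary: \<phi>)
  case (Suc d)
  have "\<phi> 0 = 0" "\<And>D. polymap d (\<lambda>x. \<phi> (x + D) - \<phi> x - \<phi> D)"
    using Suc.prems by simp_all
  then have "\<phi> 0 = 0 \<and> (\<forall>D. polymap (Suc d) (\<lambda>x. \<phi> (x + D) - \<phi> x - \<phi> D))"
    by (intro conjI allI Suc.IH)
  then show ?case by (subst polymap.simps(2))
qed simp

lemma polymap_mono:
  assumes "polymap d \<phi>" "d \<le> e"
  shows "polymap e \<phi>"
  using assms(2,1)
proof (induction rule: dec_induct)
  case (step n)
  then show ?case using polymap_Suc by blast
qed

lemma polymap_zero: "polymap d (\<lambda>x. 0)"
  by (induction d) auto

lemma polymap_diff:
  "polymap d \<phi> \<Longrightarrow> polymap d \<psi> \<Longrightarrow> polymap d (\<lambda>x. \<phi> x - \<psi> x)"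
proof (induction d arbitrary: \<phi> \<psi>)
  case (Suc d)
  have "polymap d (\<lambda>x. (\<phi> (x + D) - \<phi> x - \<phi> D) - (\<psi> (x + D) - \<psi> x - \<psi> D))" for D
    using Suc by auto
  moreover have "(\<phi> (x + D) - \<phi> x - \<phi> D) - (\<psi> (x + D) - \<psi> x - \<psi> D) =
      \<phi> (x + D) - \<psi> (x + D) - (\<phi> x - \<psi> x) - (\<phi> D - \<psi> D)" for x D
    by (simp add: algebra_simps)
  ultimately have "polymap d (\<lambda>x. \<phi> (x + D) - \<psi> (x + D) - (\<phi> x - \<psi> x) - (\<phi> D - \<psi> D))" for D
    by simp
  then show ?case using Suc.prems by simp
qed simp

lemma polymap_add:
  assumes "polymap d \<phi>" "polymap d \<psi>"
  shows "polymap d (\<lambda>x. \<phi> x + \<psi> x)"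
  using polymap_diff[OF assms(1) polymap_diff[OF polymap_zero assms(2)]] by simp

lemma polymap_sum:
  assumes "\<And>i. i \<in> I \<Longrightarrow> polymap d (\<phi> i)"
  shows "polymap d (\<lambda>x. \<Sum>i\<in>I. \<phi> i x)"
  using assms
  by (induction I rule: infinite_finite_induct) (auto simp: polymap_zero polymap_add)

section \<open>Colour focusing along finite sums of generators\<close>

definition mono_translate ::
  "(nat \<Rightarrow> 'a::ab_group_add) \<Rightarrow> ('a \<Rightarrow> 'b::ab_group_add) set \<Rightarrow> nat \<Rightarrow> nat \<Rightarrow> 'b set \<Rightarrow> ('b \<Rightarrow> nat) \<Rightarrow> bool" where
  "mono_translate b \<Phi> N0 N M \<chi> \<longleftrightarrow>
     (\<exists>a\<in>M. \<exists>H. H \<noteq> {} \<and> H \<subseteq> {N0..<N} \<and>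
        (\<forall>\<phi>\<in>\<Phi>. a + \<phi> (sum b H) \<in> M \<and> \<chi> (a + \<phi> (sum b H)) = \<chi> a))"

text \<open>The bound \<open>N0\<close> allows later index sets to be chosen disjoint from earlier
  ones. The finite window \<open>M\<close>, fixed before the colouring, can serve as the set
  \<open>E\<close> of a product colouring.\<close>

definition vdW :: "(nat \<Rightarrow> 'a::ab_group_add) \<Rightarrow> ('a \<Rightarrow> 'b::ab_group_add) set \<Rightarrow> bool" where
  "vdW b \<Phi> \<longleftrightarrow>
     (\<forall>r N0. \<exists>N M. finite M \<and> (\<forall>\<chi>. (\<forall>x. \<chi> x < r) \<longrightarrow> mono_translate b \<Phi> N0 N M \<chi>))"

text \<open>The colour of the focus \<open>a\<close> itself is left open: as soon as it lies in
  \<open>C\<close>, a monochromatic configuration appears.\<close>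

definition focused ::
  "(nat \<Rightarrow> 'a::ab_group_add) \<Rightarrow> ('a \<Rightarrow> 'b::ab_group_add) set \<Rightarrow> nat \<Rightarrow> nat \<Rightarrow> 'b set \<Rightarrow> nat \<Rightarrow> ('b \<Rightarrow> nat) \<Rightarrow> bool" where
  "focused b \<Phi> N0 N M s \<chi> \<longleftrightarrow>
     (\<exists>a\<in>M. \<exists>C. finite C \<and> card C = s \<and>
        (\<forall>c\<in>C. \<exists>H. H \<noteq> {} \<and> H \<subseteq> {N0..<N} \<and>
           (\<forall>\<phi>\<in>\<Phi>. a + \<phi> (sum b H) \<in> M \<and> \<chi> (a + \<phi> (sum b H)) = c)))"

text \<open>The pattern of colours on \<open>y + E\<close> is itself a colour of \<open>y\<close>
  with finitely many values, so \<open>vdW\<close> applies to it.\<close>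

lemma vdW_product_colouring:
  fixes b :: "nat \<Rightarrow> 'a::ab_group_add" and \<Phi> :: "('a \<Rightarrow> 'b::ab_group_add) set"
  assumes "vdW b \<Phi>" "finite E"
  shows "\<exists>N M. finite M \<and> (\<forall>\<chi>::'b \<Rightarrow> nat. (\<forall>x. \<chi> x < r) \<longrightarrow>
     (\<exists>a\<in>M. \<exists>H. H \<noteq> {} \<and> H \<subseteq> {N0..<N} \<and>
        (\<forall>\<phi>\<in>\<Phi>. a + \<phi> (sum b H) \<in> M \<and> (\<forall>e\<in>E. \<chi> (a + \<phi> (sum b H) + e) = \<chi> (a + e)))))"
proof -
  let ?S = "E \<rightarrow>\<^sub>E {..<r}"
  have "finite ?S" using assms(2) by (intro finite_PiE) auto
  \<comment> \<open>\<open>h\<close> numbers the patterns, because the colours in \<open>vdW\<close>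
    are natural numbers.\<close>
  then obtain h where h: "bij_betw h ?S {0..<card ?S}"
    using ex_bij_betw_finite_nat by blast
  obtain N M where M: "finite M"
    and NM: "\<And>\<chi>. (\<forall>x. \<chi> x < card ?S) \<Longrightarrow> mono_translate b \<Phi> N0 N M \<chi>"
    using assms(1) unfolding vdW_def by metis
  show ?thesis
  proof (intro exI conjI allI impI)
    fix \<chi> :: "'b \<Rightarrow> nat" assume \<chi>: "\<forall>x. \<chi> x < r"
    let ?p = "\<lambda>y. restrict (\<lambda>e. \<chi> (y + e)) E"
    have p: "?p y \<in> ?S" for y using \<chi> by auto
    have "\<forall>y. h (?p y) < card ?S"
      using bij_betwE[OF h] p by (metis atLeastLessThan_iff)
    from NM[OF this] obtain a H where aH: "a \<in> M" "H \<noteq> {}" "H \<subseteq> {N0..<N}"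
      and m: "\<And>\<phi>. \<phi> \<in> \<Phi> \<Longrightarrow> a + \<phi> (sum b H) \<in> M \<and> h (?p (a + \<phi> (sum b H))) = h (?p a)"
      unfolding mono_translate_def by blast
    have eq: "?p (a + \<phi> (sum b H)) = ?p a" if "\<phi> \<in> \<Phi>" for \<phi>
      by (rule inj_onD[OF bij_betw_imp_inj_on[OF h] conjunct2[OF m[OF that]] p p])
    have "\<chi> (a + \<phi> (sum b H) + e) = \<chi> (a + e)" if "\<phi> \<in> \<Phi>" "e \<in> E" for \<phi> e
      using fun_cong[OF eq[OF that(1)], of e] that(2) by simp
    with aH m show "\<exists>a\<in>M. \<exists>H. H \<noteq> {} \<and> H \<subseteq> {N0..<N} \<and>
        (\<forall>\<phi>\<in>\<Phi>. a + \<phi> (sum b H) \<in> M \<and> (\<forall>e\<in>E. \<chi> (a + \<phi> (sum b H) + e) = \<chi> (a + e)))"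
      by (intro bexI[of _ a] exI[of _ H]) simp_all
  qed (rule M)
qed

text \<open>The displacement left over when an index set with sum \<open>D\<close> is enlarged by a
  disjoint one with sum \<open>x\<close> while the focus moves by \<open>- \<phi>1 x\<close>; the
  part \<open>\<phi> D\<close> belongs to the old configuration.\<close>

definition shifted_diffs :: "('a::ab_group_add \<Rightarrow> 'b::ab_group_add) set \<Rightarrow> ('a \<Rightarrow> 'b) \<Rightarrow> 'a set \<Rightarrow> ('a \<Rightarrow> 'b) set" where
  "shifted_diffs \<Phi> \<phi>1 \<D> = (\<lambda>(\<phi>, D) x. \<phi> (x + D) - \<phi> D - \<phi>1 x) ` (\<Phi> \<times> \<D>)"

text \<open>Induction on the number \<open>s\<close> of colours. The product colouring on the old
  window \<open>M\<close> gives an \<open>x\<close> and a fresh index set \<open>H'\<close> along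
  which the colouring of \<open>x + M\<close> repeats. The old window is then used for the colouring
  translated by \<open>x\<close>: either its focus repeats a colour already present, or moving the
  focus along \<open>H'\<close> adds one more colour.\<close>

lemma vdW_focus_step:
  fixes b :: "nat \<Rightarrow> 'a::ab_group_add" and \<Phi> :: "('a \<Rightarrow> 'b::ab_group_add) set"
  assumes zero: "\<And>\<phi>. \<phi> \<in> \<Phi> \<Longrightarrow> \<phi> 0 = 0"
    and IH: "\<And>\<D>. finite \<D> \<Longrightarrow> vdW b (shifted_diffs \<Phi> \<phi>1 \<D>)"
  shows "\<exists>N M. N0 \<le> N \<and> finite M \<and> (\<forall>\<chi>::'b \<Rightarrow> nat. (\<forall>x. \<chi> x < r) \<longrightarrow>
     mono_translate b \<Phi> N0 N M \<chi> \<or> focused b \<Phi> N0 N M s \<chi>)"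
proof (induction s)
  case 0
  have "focused b \<Phi> N0 N0 {0} 0 \<chi>" for \<chi>
    unfolding focused_def by (intro bexI[of _ 0] exI[of _ "{}"]) auto
  then show ?case by (intro exI[of _ N0] exI[of _ "{0}"]) auto
next
  case (Suc s)
  then obtain N M where N0: "N0 \<le> N" and M: "finite M"
    and NM: "\<And>\<chi>. (\<forall>x. \<chi> x < r) \<Longrightarrow> mono_translate b \<Phi> N0 N M \<chi> \<or> focused b \<Phi> N0 N M s \<chi>"
    by metis
  \<comment> \<open>All sums that the old stage can produce; the empty index set contributes
    \<open>0\<close>, which handles the newly added colour.\<close>
  define \<D> where "\<D> = sum b ` Pow {N0..<N}"
  have "finite \<D>" by (simp add: \<D>_def)
  from vdW_product_colouring[OF IH[OF this] M, of r N] obtain N' M' where M': "finite M'"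
    and NM': "\<And>\<chi>. (\<forall>x. \<chi> x < r) \<Longrightarrow> \<exists>x\<in>M'. \<exists>H. H \<noteq> {} \<and> H \<subseteq> {N..<N'} \<and>
        (\<forall>\<psi>\<in>shifted_diffs \<Phi> \<phi>1 \<D>. x + \<psi> (sum b H) \<in> M' \<and>
           (\<forall>e\<in>M. \<chi> (x + \<psi> (sum b H) + e) = \<chi> (x + e)))"
    by metis
  \<comment> \<open>The second set is there to contain the new focus.\<close>
  define M2 where "M2 = (\<lambda>(x, e). x + e) ` (M' \<times> M) \<union>
    (\<lambda>(x, e, H). x + e - \<phi>1 (sum b H)) ` (M' \<times> M \<times> Pow {N..<N'})"
  define N2 where "N2 = max N N'"
  have M2: "finite M2" using M M' by (auto simp: M2_def)
  show ?case
  proof (intro exI[of _ N2] exI[of _ M2] conjI allI impI)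
    show "N0 \<le> N2" using N0 by (simp add: N2_def)
    show "finite M2" by (rule M2)
    fix \<chi> :: "'b \<Rightarrow> nat" assume \<chi>: "\<forall>x. \<chi> x < r"
    from NM'[OF \<chi>] obtain x H' where x: "x \<in> M'" and H'0: "H' \<noteq> {} \<and> H' \<subseteq> {N..<N'} \<and>
        (\<forall>\<psi>\<in>shifted_diffs \<Phi> \<phi>1 \<D>. x + \<psi> (sum b H') \<in> M' \<and>
           (\<forall>e\<in>M. \<chi> (x + \<psi> (sum b H') + e) = \<chi> (x + e)))"
      by (elim bexE exE)
    then have H': "H' \<noteq> {}" "H' \<subseteq> {N..<N'}"
      and shift: "\<And>\<psi>. \<psi> \<in> shifted_diffs \<Phi> \<phi>1 \<D> \<Longrightarrow> x + \<psi> (sum b H') \<in> M' \<and>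
           (\<forall>e\<in>M. \<chi> (x + \<psi> (sum b H') + e) = \<chi> (x + e))" by simp_all
    have inM2: "y + e \<in> M2" if "y \<in> M'" "e \<in> M" for y e
      using that by (auto simp: M2_def)
    have shift': "x + (\<phi> (sum b H' + D) - \<phi> D - \<phi>1 (sum b H')) \<in> M' \<and>
        (\<forall>e\<in>M. \<chi> (x + (\<phi> (sum b H' + D) - \<phi> D - \<phi>1 (sum b H')) + e) = \<chi> (x + e))"
      if "\<phi> \<in> \<Phi>" "D \<in> \<D>" for \<phi> D
    proof -
      have "(\<lambda>x. \<phi> (x + D) - \<phi> D - \<phi>1 x) \<in> shifted_diffs \<Phi> \<phi>1 \<D>"
        unfolding shifted_diffs_def by (rule image_eqI[where x = "(\<phi>, D)"]) (use that in auto)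
      from shift[OF this] show ?thesis .
    qed
    have mono: "mono_translate b \<Phi> N0 N2 M2 \<chi>"
      if "a \<in> M" "H \<noteq> {}" "H \<subseteq> {N0..<N}"
        "\<And>\<phi>. \<phi> \<in> \<Phi> \<Longrightarrow> a + \<phi> (sum b H) \<in> M \<and> \<chi> (x + (a + \<phi> (sum b H))) = \<chi> (x + a)" for a H
      unfolding mono_translate_def
    proof (intro bexI[of _ "x + a"] exI[of _ H] conjI ballI)
      show "H \<subseteq> {N0..<N2}" using that(3) by (force simp: N2_def)
      fix \<phi> assume "\<phi> \<in> \<Phi>"
      with that(4) inM2[OF x] show "x + a + \<phi> (sum b H) \<in> M2" "\<chi> (x + a + \<phi> (sum b H)) = \<chi> (x + a)"
        by (metis add.assoc)+
    qed (use that inM2[OF x] in auto)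
    have "mono_translate b \<Phi> N0 N M (\<lambda>y. \<chi> (x + y)) \<or> focused b \<Phi> N0 N M s (\<lambda>y. \<chi> (x + y))"
      using \<chi> by (intro NM) simp
    then show "mono_translate b \<Phi> N0 N2 M2 \<chi> \<or> focused b \<Phi> N0 N2 M2 (Suc s) \<chi>"
    proof (elim disjE)
      assume "mono_translate b \<Phi> N0 N M (\<lambda>y. \<chi> (x + y))"
      then obtain a H where "a \<in> M" and H: "H \<noteq> {} \<and> H \<subseteq> {N0..<N} \<and>
        (\<forall>\<phi>\<in>\<Phi>. a + \<phi> (sum b H) \<in> M \<and> \<chi> (x + (a + \<phi> (sum b H))) = \<chi> (x + a))"
        unfolding mono_translate_def by (elim bexE exE)
      then have "mono_translate b \<Phi> N0 N2 M2 \<chi>" by (intro mono[of a H]) simp_all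
      then show ?thesis ..
    next
      assume "focused b \<Phi> N0 N M s (\<lambda>y. \<chi> (x + y))"
      then obtain a C where a: "a \<in> M" and C: "finite C" "card C = s"
        and foc: "\<And>c. c \<in> C \<Longrightarrow> \<exists>H. H \<noteq> {} \<and> H \<subseteq> {N0..<N} \<and>
           (\<forall>\<phi>\<in>\<Phi>. a + \<phi> (sum b H) \<in> M \<and> \<chi> (x + (a + \<phi> (sum b H))) = c)"
        unfolding focused_def by blast
      show ?thesis
      proof (cases "\<chi> (x + a) \<in> C")
        case True
        from foc[OF this] obtain H where "H \<noteq> {} \<and> H \<subseteq> {N0..<N} \<and>
          (\<forall>\<phi>\<in>\<Phi>. a + \<phi> (sum b H) \<in> M \<and> \<chi> (x + (a + \<phi> (sum b H))) = \<chi> (x + a))" ..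
        with a have "mono_translate b \<Phi> N0 N2 M2 \<chi>" by (intro mono[of a H]) simp_all
        then show ?thesis ..
      next
        case False
        \<comment> \<open>From the new focus, the old colours are reached along
          \<open>H' \<union> H\<close> and the colour of \<open>x + a\<close> along
          \<open>H'\<close> alone.\<close>
        define a' where "a' = x + a - \<phi>1 (sum b H')"
        have "focused b \<Phi> N0 N2 M2 (Suc s) \<chi>"
          unfolding focused_def
        proof (rule bexI[of _ a'], rule exI[of _ "insert (\<chi> (x + a)) C"], intro conjI ballI)
          show "a' \<in> M2" using x a H' unfolding a'_def M2_def by force
          show "finite (insert (\<chi> (x + a)) C)" "card (insert (\<chi> (x + a)) C) = Suc s"
            using C False by auto
          fix c assume c: "c \<in> insert (\<chi> (x + a)) C"
          show "\<exists>H. H \<noteq> {} \<and> H \<subseteq> {N0..<N2} \<and>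
             (\<forall>\<phi>\<in>\<Phi>. a' + \<phi> (sum b H) \<in> M2 \<and> \<chi> (a' + \<phi> (sum b H)) = c)"
          proof (cases "c \<in> C")
            case True
            then obtain H where H: "H \<noteq> {}" "H \<subseteq> {N0..<N}"
              and h: "\<And>\<phi>. \<phi> \<in> \<Phi> \<Longrightarrow> a + \<phi> (sum b H) \<in> M \<and> \<chi> (x + (a + \<phi> (sum b H))) = c"
              using foc by metis
            have D: "sum b H \<in> \<D>" using H by (auto simp: \<D>_def)
            have "sum b (H' \<union> H) = sum b H' + sum b H"
              using H H' by (intro sum.union_disjoint) (auto intro: finite_subset, fastforce)
            then have eq: "a' + \<phi> (sum b (H' \<union> H)) =
                x + (\<phi> (sum b H' + sum b H) - \<phi> (sum b H) - \<phi>1 (sum b H')) + (a + \<phi> (sum b H))" for \<phi>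
              by (simp add: a'_def algebra_simps)
            show ?thesis
            proof (intro exI[of _ "H' \<union> H"] conjI ballI)
              show "H' \<union> H \<noteq> {}" using H by auto
              show "H' \<union> H \<subseteq> {N0..<N2}" using H H' N0 by (fastforce simp: N2_def)
              fix \<phi> assume "\<phi> \<in> \<Phi>"
              note * = shift'[OF this D] h[OF this]
              show "a' + \<phi> (sum b (H' \<union> H)) \<in> M2"
                unfolding eq using * by (intro inM2) simp_all
              show "\<chi> (a' + \<phi> (sum b (H' \<union> H))) = c"
                unfolding eq using * by metis
            qed
          next
            case False
            then have c: "c = \<chi> (x + a)" using c by simp
            have D: "0 \<in> \<D>" unfolding \<D>_def by (rule image_eqI[of _ _ "{}"]) auto
            have eq: "a' + \<phi> (sum b H') = x + (\<phi> (sum b H' + 0) - \<phi> 0 - \<phi>1 (sum b H')) + a"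
              if "\<phi> \<in> \<Phi>" for \<phi>
              using zero[OF that] by (simp add: a'_def algebra_simps)
            show ?thesis
            proof (intro exI[of _ H'] conjI ballI)
              show "H' \<noteq> {}" by (rule H')
              show "H' \<subseteq> {N0..<N2}" using H' N0 by (fastforce simp: N2_def)
              fix \<phi> assume \<phi>: "\<phi> \<in> \<Phi>"
              note * = shift'[OF \<phi> D]
              show "a' + \<phi> (sum b H') \<in> M2"
                unfolding eq[OF \<phi>] using * a by (intro inM2) simp_all
              show "\<chi> (a' + \<phi> (sum b H')) = c"
                unfolding eq[OF \<phi>] c using * a by metis
            qed
          qed
        qed
        then show ?thesis ..
      qed
    qed
  qed
qed

text \<open>With \<open>r\<close> colours, \<open>Suc r\<close> differently coloured configurations
  cannot coexist, so the other alternative of the focusing step holds. A member of \<Phi> ensures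
  that each colour in \<open>C\<close> is really attained.\<close>

lemma vdW_by_focusing:
  fixes b :: "nat \<Rightarrow> 'a::ab_group_add" and \<Phi> :: "('a \<Rightarrow> 'b::ab_group_add) set"
  assumes "\<Phi> \<noteq> {}" and zero: "\<And>\<phi>. \<phi> \<in> \<Phi> \<Longrightarrow> \<phi> 0 = 0"
    and IH: "\<And>\<D>. finite \<D> \<Longrightarrow> vdW b (shifted_diffs \<Phi> \<phi>1 \<D>)"
  shows "vdW b \<Phi>"
  unfolding vdW_def
proof (intro allI)
  fix r N0
  have "\<exists>N M. N0 \<le> N \<and> finite M \<and> (\<forall>\<chi>::'b \<Rightarrow> nat. (\<forall>x. \<chi> x < r) \<longrightarrow>
     mono_translate b \<Phi> N0 N M \<chi> \<or> focused b \<Phi> N0 N M (Suc r) \<chi>)"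
    by (rule vdW_focus_step) (rule zero IH; assumption)+
  then obtain N M where M: "finite M"
    and NM: "\<And>\<chi>. (\<forall>x. \<chi> x < r) \<Longrightarrow> mono_translate b \<Phi> N0 N M \<chi> \<or> focused b \<Phi> N0 N M (Suc r) \<chi>"
    by blast
  have "\<not> focused b \<Phi> N0 N M (Suc r) \<chi>" if \<chi>: "\<forall>x. \<chi> x < r" for \<chi>
  proof
    assume "focused b \<Phi> N0 N M (Suc r) \<chi>"
    then obtain a C where C: "card C = Suc r" and foc: "\<forall>c\<in>C. \<exists>H. H \<noteq> {} \<and> H \<subseteq> {N0..<N} \<and>
        (\<forall>\<phi>\<in>\<Phi>. a + \<phi> (sum b H) \<in> M \<and> \<chi> (a + \<phi> (sum b H)) = c)"
      unfolding focused_def by (elim bexE exE conjE)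
    obtain \<phi> where "\<phi> \<in> \<Phi>" using assms(1) by blast
    have "C \<subseteq> {..<r}"
    proof
      fix c assume "c \<in> C"
      from bspec[OF foc this] obtain H where
        "\<forall>\<phi>\<in>\<Phi>. a + \<phi> (sum b H) \<in> M \<and> \<chi> (a + \<phi> (sum b H)) = c"
        by (elim exE conjE)
      then have "c = \<chi> (a + \<phi> (sum b H))" using \<open>\<phi> \<in> \<Phi>\<close> by simp
      then show "c \<in> {..<r}" using \<chi> by simp
    qed
    then have "card C \<le> r" using card_mono[of "{..<r}" C] by simp
    with C show False by simp
  qed
  with M NM show "\<exists>N M. finite M \<and> (\<forall>\<chi>. (\<forall>x. \<chi> x < r) \<longrightarrow> mono_translate b \<Phi> N0 N M \<chi>)"
    by blast
qed

section \<open>PET induction\<close>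

text \<open>The zero map only asks for \<open>a\<close> itself, which is in \<open>M\<close>
  already.\<close>

lemma vdW_remove_zero:
  assumes "vdW b (\<Phi> - {\<lambda>x. 0})"
  shows "vdW b \<Phi>"
proof -
  have "mono_translate b \<Phi> N0 N M \<chi>" if "mono_translate b (\<Phi> - {\<lambda>x. 0}) N0 N M \<chi>" for N0 N M \<chi>
  proof -
    from that obtain a H where *: "a \<in> M" "H \<noteq> {}" "H \<subseteq> {N0..<N}"
      "\<forall>\<phi>\<in>\<Phi> - {\<lambda>x. 0}. a + \<phi> (sum b H) \<in> M \<and> \<chi> (a + \<phi> (sum b H)) = \<chi> a"
      unfolding mono_translate_def by (elim bexE exE conjE)
    have "a + \<phi> (sum b H) \<in> M \<and> \<chi> (a + \<phi> (sum b H)) = \<chi> a" if "\<phi> \<in> \<Phi>" for \<phi>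
      using *(1,4) that by (cases "\<phi> = (\<lambda>x. 0)") auto
    with * show ?thesis
      unfolding mono_translate_def by (intro bexI[of _ a] exI[of _ H]) simp_all
  qed
  with assms show ?thesis unfolding vdW_def by meson
qed

lemma vdW_empty: "vdW b {}"
  unfolding vdW_def
proof (intro allI)
  fix r N0
  have "mono_translate b {} N0 (Suc N0) {0} \<chi>" for \<chi>
    unfolding mono_translate_def by (intro bexI[of _ 0] exI[of _ "{N0}"]) auto
  then show "\<exists>N M. finite M \<and> (\<forall>\<chi>. (\<forall>x. \<chi> x < r) \<longrightarrow> mono_translate b {} N0 N M \<chi>)"
    by (intro exI[of _ "Suc N0"] exI[of _ "{0}"]) auto
qed

text \<open>
  The multiset of second components, under the multiset order, is the weight of PET induction: \<open>(\<psi>, e)\<close>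
  stands for the coset of \<open>\<psi>\<close>, of degree at most \<open>e + 1\<close>, modulo maps of degree at most \<open>e\<close>.
  Passing to \<open>shifted_diffs\<close> at a \<open>\<phi>1\<close> of minimal \<open>e\<close> replaces its coset by finitely many smaller ones.
\<close>

definition coset_cover :: "(('a::ab_group_add \<Rightarrow> 'b::ab_group_add) \<times> nat) multiset \<Rightarrow> ('a \<Rightarrow> 'b) set \<Rightarrow> bool" where
  "coset_cover X \<Phi> \<longleftrightarrow> (\<forall>(\<psi>, e) \<in># X. polymap (Suc e) \<psi>) \<and>
     (\<forall>\<phi>\<in>\<Phi>. \<exists>(\<psi>, e) \<in># X. polymap e (\<lambda>x. \<phi> x - \<psi> x))"

text \<open>Well-founded induction on the weight. The focusing lemma reduces \<Phi> to
  \<open>shifted_diffs\<close>, for which a cover of smaller weight is exhibited.\<close>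

lemma vdW_of_coset_cover:
  assumes "coset_cover X \<Phi>" "finite \<Phi>"
  shows "vdW b \<Phi>"
proof -
  have "wf (inv_image (mult less_than) (image_mset snd :: (('a \<Rightarrow> 'b) \<times> nat) multiset \<Rightarrow> nat multiset))"
    by (rule wf_inv_image[OF wf_mult[OF wf_less_than]])
  then show ?thesis using assms
  proof (induction X arbitrary: \<Phi> rule: wf_induct_rule)
    case (less X \<Phi>)
    note cov = less.prems(1) and fin = less.prems(2)
    show ?case
    proof (cases "X = {#}")
      case True
      then have "\<Phi> = {}" using cov by (auto simp: coset_cover_def)
      then show ?thesis using vdW_empty by blast
    next
      case False
      then have "Min (snd ` set_mset X) \<in> snd ` set_mset X" by (intro Min_in) auto
      then obtain \<psi>1 e1 where p1: "(\<psi>1, e1) \<in># X" and e1: "e1 = Min (snd ` set_mset X)"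
        by (metis imageE prod.collapse)
      have le: "e1 \<le> e" if "(\<psi>, e) \<in># X" for \<psi> e
        unfolding e1 using that image_eqI[of e snd "(\<psi>, e)" "set_mset X"] by (intro Min_le) auto
      define Y where "Y = X - {#(\<psi>1, e1)#}"
      have X: "X = add_mset (\<psi>1, e1) Y" using p1 by (simp add: Y_def)
      \<comment> \<open>Trading one entry \<open>e1\<close> for any number of smaller entries lowers
        the weight.\<close>
      have decr: "(image_mset snd Y + K, image_mset snd X) \<in> mult less_than"
        if "\<And>k. k \<in># K \<Longrightarrow> k < e1" for K
        using that one_step_implies_mult[of "{#e1#}" K less_than "image_mset snd Y"] by (simp add: X)
      show ?thesis
      proof (cases "\<exists>\<phi>1\<in>\<Phi>. polymap e1 (\<lambda>x. \<phi>1 x - \<psi>1 x)")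
        case False
        then have "coset_cover Y \<Phi>" using cov unfolding coset_cover_def X by auto
        moreover have "(image_mset snd Y, image_mset snd X) \<in> mult less_than"
          using decr[of "{#}"] by simp
        ultimately show ?thesis using less.IH[of Y] fin by simp
      next
        case True
        then obtain \<phi>1 where \<phi>1: "\<phi>1 \<in> \<Phi>" "polymap e1 (\<lambda>x. \<phi>1 x - \<psi>1 x)" by blast
        have deg: "polymap (Suc e) \<phi>"
          if "(\<psi>, e) \<in># X" "polymap e (\<lambda>x. \<phi> x - \<psi> x)" for \<phi> \<psi> e
        proof -
          have "polymap (Suc e) \<psi>" using cov that unfolding coset_cover_def by auto
          from polymap_add[OF polymap_Suc[OF that(2)] this] show ?thesis by simp
        qed
        have deg1: "polymap (Suc e1) \<phi>1" using deg p1 \<phi>1 by blast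
        have zero: "\<phi> 0 = 0" if "\<phi> \<in> \<Phi>" for \<phi>
        proof -
          from that cov obtain \<psi> e where "(\<psi>, e) \<in># X" "polymap e (\<lambda>x. \<phi> x - \<psi> x)"
            unfolding coset_cover_def by blast
          then show ?thesis using deg by (metis polymap.simps(2))
        qed
        show ?thesis
        proof (rule vdW_by_focusing[of \<Phi> b \<phi>1])
          show "\<Phi> \<noteq> {}" using \<phi>1 by blast
          show "\<phi> 0 = 0" if "\<phi> \<in> \<Phi>" for \<phi> by (rule zero[OF that])
          fix \<D> :: "'a set" assume D: "finite \<D>"
          \<comment> \<open>Without the zero map, nothing in \<Psi> has degree bound 0, so for
            \<open>e1 = 0\<close> no entry below \<open>e1\<close> is required.\<close>
          define \<Psi> where "\<Psi> = shifted_diffs \<Phi> \<phi>1 \<D> - {\<lambda>x. 0}"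
          \<comment> \<open>\<open>L\<close> takes in everything in \<Psi> that is covered only by
            the removed entry. Each of its maps represents its own coset, with exponent
            \<open>e1 - 1\<close>; the other cosets are merely translated by
            \<open>- \<phi>1\<close>.\<close>
          define L where "L = {\<psi> \<in> \<Psi>. polymap e1 \<psi>}"
          define X' where "X' = image_mset (\<lambda>(\<psi>, e). (\<lambda>x. \<psi> x - \<phi>1 x, e)) Y +
            image_mset (\<lambda>\<psi>. (\<psi>, e1 - 1)) (mset_set L)"
          have fin': "finite \<Psi>" using fin D by (simp add: \<Psi>_def shifted_diffs_def)
          then have finL: "finite L" by (simp add: L_def)
          have L0: "e1 > 0" if "L \<noteq> {}"
            using that by (cases e1) (auto simp: L_def \<Psi>_def)
          have "coset_cover X' \<Psi>"
            unfolding coset_cover_def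
          proof (intro conjI ballI)
            fix z assume "z \<in># X'"
            then consider \<psi> e where "(\<psi>, e) \<in># Y" "z = (\<lambda>x. \<psi> x - \<phi>1 x, e)"
              | \<psi> where "\<psi> \<in> L" "z = (\<psi>, e1 - 1)"
              using finL by (auto simp: X'_def)
            then show "case z of (\<psi>, e) \<Rightarrow> polymap (Suc e) \<psi>"
            proof cases
              case 1
              then have "(\<psi>, e) \<in># X" by (simp add: X)
              have "polymap (Suc e) \<psi>"
                using cov \<open>(\<psi>, e) \<in># X\<close> unfolding coset_cover_def by blast
              \<comment> \<open>Minimality of \<open>e1\<close> is used here: subtracting
                \<open>\<phi>1\<close> does not raise the degree of any other coset.\<close>
              moreover have "polymap (Suc e) \<phi>1"
                using le[OF \<open>(\<psi>, e) \<in># X\<close>] by (intro polymap_mono[OF deg1]) simp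
              ultimately have "polymap (Suc e) (\<lambda>x. \<psi> x - \<phi>1 x)" by (rule polymap_diff)
              then show ?thesis using 1 by (simp only: prod.case)
            next
              case 2
              moreover from 2(1) have "L \<noteq> {}" by blast
              then have "Suc (e1 - 1) = e1" using L0 by simp
              ultimately show ?thesis by (simp only: prod.case L_def mem_Collect_eq)
            qed
          next
            fix \<theta> assume \<theta>: "\<theta> \<in> \<Psi>"
            then obtain \<phi> D where \<phi>: "\<phi> \<in> \<Phi>" and \<theta>_eq: "\<theta> = (\<lambda>x. \<phi> (x + D) - \<phi> D - \<phi>1 x)"
              by (auto simp: \<Psi>_def shifted_diffs_def)
            from \<phi> cov obtain \<psi> e where \<psi>: "(\<psi>, e) \<in># X" "polymap e (\<lambda>x. \<phi> x - \<psi> x)"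
              unfolding coset_cover_def by blast
            \<comment> \<open>Translating the argument by \<open>D\<close> and subtracting
              \<open>\<phi> D\<close> changes \<phi> only by a map of lower degree, so the result
              stays in the coset of \<psi>.\<close>
            have "polymap e (\<lambda>x. \<phi> (x + D) - \<phi> x - \<phi> D)"
              using deg[OF \<psi>] by simp
            from polymap_add[OF this \<psi>(2)]
            have same: "polymap e (\<lambda>x. \<phi> (x + D) - \<phi> D - \<psi> x)" by (simp add: algebra_simps)
            show "\<exists>(\<psi>, e) \<in># X'. polymap e (\<lambda>x. \<theta> x - \<psi> x)"
            proof (cases "(\<psi>, e) \<in># Y")
              case True
              then have mem: "(\<lambda>x. \<psi> x - \<phi>1 x, e) \<in># X'" by (force simp: X'_def)
              have "polymap e (\<lambda>x. \<theta> x - (\<psi> x - \<phi>1 x))"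
                using same by (simp add: \<theta>_eq)
              then show ?thesis by (intro bexI[OF _ mem]) simp
            next
              case False
              then have [simp]: "\<psi> = \<psi>1" "e = e1" using \<psi>(1) by (auto simp: X)
              from polymap_diff[OF same[simplified] \<phi>1(2)] have "polymap e1 \<theta>"
                by (simp add: \<theta>_eq)
              then have mem: "(\<theta>, e1 - 1) \<in># X'" using \<theta> finL by (auto simp: X'_def L_def)
              have "polymap (e1 - 1) (\<lambda>x. \<theta> x - \<theta> x)" by (simp add: polymap_zero)
              then show ?thesis by (intro bexI[OF _ mem]) simp
            qed
          qed
          moreover have "(image_mset snd X', image_mset snd X) \<in> mult less_than"
          proof -
            have eq: "image_mset snd X' = image_mset snd Y + image_mset (\<lambda>\<psi>. e1 - 1) (mset_set L)"
              by (simp add: X'_def multiset.map_comp o_def case_prod_unfold)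
            show ?thesis
              unfolding eq
            proof (rule decr)
              fix k assume "k \<in># image_mset (\<lambda>\<psi>. e1 - 1) (mset_set L)"
              then have "L \<noteq> {}" "k = e1 - 1" using finL by auto
              then show "k < e1" using L0 by simp
            qed
          qed
          ultimately have "vdW b \<Psi>" using less.IH[of X'] fin' by simp
          then show "vdW b (shifted_diffs \<Phi> \<phi>1 \<D>)" unfolding \<Psi>_def by (rule vdW_remove_zero)
        qed
      qed
    qed
  qed
qed

text \<open>Each map is its own coset representative, so every finite family has a cover.\<close>

lemma polymap_vdW:
  assumes "finite \<Phi>" "\<And>\<phi>. \<phi> \<in> \<Phi> \<Longrightarrow> \<exists>d. polymap d \<phi>"
  shows "vdW b \<Phi>"
proof -
  obtain d where d: "\<And>\<phi>. \<phi> \<in> \<Phi> \<Longrightarrow> polymap (d \<phi>) \<phi>" using assms(2) by metis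
  have up: "polymap (Suc (d \<phi>)) \<phi>" if "\<phi> \<in> \<Phi>" for \<phi>
    by (rule polymap_Suc[OF d[OF that]])
  have "coset_cover (image_mset (\<lambda>\<phi>. (\<phi>, d \<phi>)) (mset_set \<Phi>)) \<Phi>"
    unfolding coset_cover_def
  proof (intro conjI ballI)
    fix z assume "z \<in># image_mset (\<lambda>\<phi>. (\<phi>, d \<phi>)) (mset_set \<Phi>)"
    then obtain \<phi> where "\<phi> \<in> \<Phi>" "z = (\<phi>, d \<phi>)" using assms(1) by auto
    then show "case z of (\<psi>, e) \<Rightarrow> polymap (Suc e) \<psi>" using up by (simp only: prod.case)
  next
    fix \<phi> assume "\<phi> \<in> \<Phi>"
    then show "\<exists>(\<psi>, e) \<in># image_mset (\<lambda>\<phi>. (\<phi>, d \<phi>)) (mset_set \<Phi>). polymap e (\<lambda>x. \<phi> x - \<psi> x)"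
      using assms(1) by (intro bexI[of _ "(\<phi>, d \<phi>)"]) (auto simp: polymap_zero)
  qed
  then show ?thesis using assms(1) by (rule vdW_of_coset_cover)
qed

section \<open>Piecewise syndetic sets\<close>

text \<open>
  Piecewise syndetic: bounded gaps on arbitrarily long intervals, which moreover are required to lie
  arbitrarily far to the right.
\<close>

definition pws :: "int set \<Rightarrow> bool" where
  "pws B \<longleftrightarrow> (\<exists>m. \<forall>L. \<exists>u\<ge>L. \<forall>x\<in>{u..u + L}. \<exists>y\<in>B. x \<le> y \<and> y \<le> x + m)"

lemma pwsE:
  assumes "pws B"
  obtains m where "m \<ge> 0" "\<And>L. \<exists>u\<ge>L. \<forall>x\<in>{u..u + L}. \<exists>y\<in>B. x \<le> y \<and> y \<le> x + m"
proof -
  from assms obtain m where m: "\<And>L. \<exists>u\<ge>L. \<forall>x\<in>{u..u + L}. \<exists>y\<in>B. x \<le> y \<and> y \<le> x + m"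
    unfolding pws_def by blast
  from m[of 0] have "m \<ge> 0" by force
  with m that show thesis by blast
qed

lemma pws_mono: "pws A \<Longrightarrow> A \<subseteq> B \<Longrightarrow> pws B"
  unfolding pws_def by (meson subsetD)

lemma pws_shift:
  assumes "pws ((\<lambda>y. y + t) -` B)"
  shows "pws B"
proof -
  obtain m where m: "\<And>L. \<exists>u\<ge>L. \<forall>x\<in>{u..u + L}. \<exists>y\<in>(\<lambda>y. y + t) -` B. x \<le> y \<and> y \<le> x + m"
    using assms unfolding pws_def by blast
  show ?thesis
    unfolding pws_def
  proof (rule exI[of _ m], rule allI)
    fix L
    obtain u where u: "u \<ge> L + \<bar>t\<bar>"
      "\<forall>x\<in>{u..u + (L + \<bar>t\<bar>)}. \<exists>y\<in>(\<lambda>y. y + t) -` B. x \<le> y \<and> y \<le> x + m"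
      using m[of "L + \<bar>t\<bar>"] by blast
    show "\<exists>u\<ge>L. \<forall>x\<in>{u..u + L}. \<exists>y\<in>B. x \<le> y \<and> y \<le> x + m"
    proof (intro exI[of _ "u + t"] conjI ballI)
      show "L \<le> u + t" using u(1) by linarith
      fix x assume "x \<in> {u + t..u + t + L}"
      then have "x - t \<in> {u..u + (L + \<bar>t\<bar>)}" by auto
      from bspec[OF u(2) this] obtain y where "y + t \<in> B" "x - t \<le> y" "y \<le> x - t + m" by auto
      then show "\<exists>y\<in>B. x \<le> y \<and> y \<le> x + m" by (intro bexI[of _ "y + t"]) auto
    qed
  qed
qed

text \<open>If \<open>A2\<close> is not piecewise syndetic, a long interval on which the union has
  gaps at most \<open>m\<close> contains a long subinterval free of \<open>A2\<close>, and there
  \<open>A1\<close> alone has gaps at most \<open>m\<close>.\<close>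

lemma pws_Un:
  assumes "pws (A1 \<union> A2)"
  shows "pws A1 \<or> pws A2"
proof (rule disjCI)
  assume not2: "\<not> pws A2"
  obtain m where m0: "m \<ge> 0"
    and m: "\<And>L. \<exists>u\<ge>L. \<forall>x\<in>{u..u + L}. \<exists>y\<in>A1 \<union> A2. x \<le> y \<and> y \<le> x + m"
    using pwsE[OF assms] by blast
  show "pws A1"
    unfolding pws_def
  proof (rule exI[of _ m], rule allI)
    fix L0 :: int
    define L where "L = max L0 0"
    \<comment> \<open>Failure for the gap bound \<open>L + m\<close>: the \<open>A2\<close>-free
      stretch must also contain the next \<open>m\<close> points after each of its first
      \<open>L\<close>.\<close>
    from not2 obtain K where K: "\<And>u. u \<ge> K \<Longrightarrow> \<exists>x\<in>{u..u + K}. \<forall>y\<in>A2. \<not> (x \<le> y \<and> y \<le> x + (L + m))"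
      unfolding pws_def by metis
    obtain u where u: "u \<ge> max K 0 + L" and
      um: "\<And>x. x \<in> {u..u + (max K 0 + L)} \<Longrightarrow> \<exists>y\<in>A1 \<union> A2. x \<le> y \<and> y \<le> x + m"
      using m[of "max K 0 + L"] by blast
    have "u \<ge> K" using u by (simp add: L_def)
    then obtain v where v: "v \<in> {u..u + K}" and gap: "\<And>y. y \<in> A2 \<Longrightarrow> \<not> (v \<le> y \<and> y \<le> v + (L + m))"
      using K by blast
    show "\<exists>u\<ge>L0. \<forall>x\<in>{u..u + L0}. \<exists>y\<in>A1. x \<le> y \<and> y \<le> x + m"
    proof (intro exI[of _ v] conjI ballI)
      show "L0 \<le> v" using u v by (auto simp: L_def)
      fix x assume x: "x \<in> {v..v + L0}"
      then have "x \<in> {u..u + (max K 0 + L)}" using v by (auto simp: L_def)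
      then obtain y where y: "y \<in> A1 \<union> A2" "x \<le> y" "y \<le> x + m" using um by blast
      then have "y \<notin> A2" using gap[of y] x by (auto simp: L_def)
      with y show "\<exists>y\<in>A1. x \<le> y \<and> y \<le> x + m" by blast
    qed
  qed
qed

lemma not_pws_bounded:
  assumes "\<And>x. x \<in> B \<Longrightarrow> x < c"
  shows "\<not> pws B"
proof
  assume "pws B"
  then obtain m where m: "m \<ge> 0" "\<And>L. \<exists>u\<ge>L. \<forall>x\<in>{u..u + L}. \<exists>y\<in>B. x \<le> y \<and> y \<le> x + m"
    using pwsE by blast
  obtain u where u: "u \<ge> max c 0" "\<forall>x\<in>{u..u + max c 0}. \<exists>y\<in>B. x \<le> y \<and> y \<le> x + m"
    using m(2)[of "max c 0"] by blast
  then obtain y where "y \<in> B" "u \<le> y" by force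
  then show False using assms u by force
qed

lemma not_pws_empty: "\<not> pws {}"
  by (rule not_pws_bounded) simp

lemma pws_UN:
  assumes "finite I" "pws (\<Union>i\<in>I. A i)"
  shows "\<exists>i\<in>I. pws (A i)"
  using assms
proof (induction I)
  case empty
  then show ?case using not_pws_empty by simp
next
  case (insert i I)
  then have "pws (A i \<union> (\<Union>i\<in>I. A i))" by simp
  then show ?case using insert.IH pws_Un by blast
qed

lemma pws_nonneg:
  assumes "pws B"
  shows "\<exists>x\<in>B. x \<ge> 0"
  using not_pws_bounded[of B 0] assms by force

section \<open>Ultrafilters all of whose members are piecewise syndetic\<close>

text \<open>Finer filters are smaller in this order, so Zorn's lemma yields a minimal proper filter.
  Adjoining a set whose complement is not a member keeps it proper, so by minimality the set was a
  member already.\<close>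

lemma ultrafilter_below:
  fixes F :: "'a filter"
  assumes "F \<noteq> bot"
  shows "\<exists>p\<le>F. ultrafilter p"
proof -
  define S where "S = {G. G \<noteq> bot \<and> G \<le> F}"
  have "\<exists>p\<in>S. \<forall>G\<in>S. p \<ge> G \<longrightarrow> G = p"
  proof (rule predicate_Zorn[where P = "(\<ge>)"])
    show "partial_order_on S (relation_of (\<ge>) S)"
      by (rule partial_order_on_relation_ofI) auto
  next
    fix C assume C: "C \<in> Chains (relation_of (\<ge>) S)"
    have CS: "C \<subseteq> S" using C by (auto simp: Chains_def relation_of_def)
    have lin: "G \<le> H \<or> H \<le> G" if "G \<in> C" "H \<in> C" for G H
      using C that by (auto simp: Chains_def relation_of_def)
    show "\<exists>u\<in>S. \<forall>a\<in>C. a \<ge> u"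
    proof (cases "C = {}")
      case True
      then show ?thesis using assms by (auto simp: S_def)
    next
      case False
      have "eventually P (Inf C) \<longleftrightarrow> (\<exists>b\<in>C. eventually P b)" for P
        using False lin by (intro eventually_Inf_base) (meson inf_greatest order_refl)+
      then have "Inf C \<noteq> bot"
        using CS by (auto simp: S_def trivial_limit_def)
      moreover have "Inf C \<le> F" using False CS by (auto simp: S_def intro: Inf_lower2)
      ultimately show ?thesis by (auto simp: S_def intro: Inf_lower)
    qed
  qed
  then obtain p where p: "p \<noteq> bot" "p \<le> F" and max: "\<And>G. G \<noteq> bot \<Longrightarrow> G \<le> p \<Longrightarrow> G = p"
    unfolding S_def by (metis (mono_tags, lifting) mem_Collect_eq order_trans)
  have "eventually P p \<or> eventually (\<lambda>x. \<not> P x) p" for P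
  proof (rule disjCI)
    assume "\<not> eventually (\<lambda>x. \<not> P x) p"
    then have "inf p (principal {x. P x}) \<noteq> bot"
      by (simp add: trivial_limit_def eventually_inf_principal)
    then have "inf p (principal {x. P x}) = p" using max by simp
    moreover have "eventually P (inf p (principal {x. P x}))"
      by (simp add: eventually_inf_principal)
    ultimately show "eventually P p" by simp
  qed
  with p show ?thesis by (auto simp: ultrafilter_def)
qed

lemma ultrafilter_tensor:
  assumes "ultrafilter p" "ultrafilter r"
  shows "ultrafilter (p \<otimes>\<^sub>u r)"
  unfolding ultrafilter_def
proof (intro conjI allI)
  show "p \<otimes>\<^sub>u r \<noteq> bot"
    using assms by (simp add: ultrafilter_def trivial_limit_def eventually_tensor)
  fix P :: "'a \<times> 'b \<Rightarrow> bool"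
  have "eventually (\<lambda>y. \<not> P (x, y)) r" if "\<not> eventually (\<lambda>y. P (x, y)) r" for x
    using assms(2) that unfolding ultrafilter_def by blast
  moreover have "eventually (\<lambda>x. eventually (\<lambda>y. P (x, y)) r) p \<or>
      eventually (\<lambda>x. \<not> eventually (\<lambda>y. P (x, y)) r) p"
    using assms(1) unfolding ultrafilter_def by blast
  ultimately show "eventually P (p \<otimes>\<^sub>u r) \<or> eventually (\<lambda>z. \<not> P z) (p \<otimes>\<^sub>u r)"
    unfolding eventually_tensor by (metis (mono_tags, lifting) eventually_mono)
qed

lemma beta_add_in_betaN:
  assumes "p \<in> betaN" "r \<in> betaN"
  shows "p +\<^sub>\<beta> r \<in> betaN"
proof -
  have "ultrafilter (p \<otimes>\<^sub>u r)" using assms by (simp add: betaN_def ultrafilter_tensor)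
  then have "ultrafilter (p +\<^sub>\<beta> r)"
    unfolding ultrafilter_def beta_add_def by (simp add: filtermap_bot_iff eventually_filtermap)
  moreover have "eventually (\<lambda>x. x > 0) (p +\<^sub>\<beta> r)"
    using assms unfolding eventually_beta_add betaN_def by (auto elim!: eventually_mono)
  ultimately show ?thesis by (simp add: betaN_def)
qed

text \<open>The closure of \<open>K(\<beta>\<nat>)\<close>; only that it is some two-sided ideal matters.\<close>

definition pws_ultrafilters :: "nat filter set" where
  "pws_ultrafilters = {p \<in> betaN. \<forall>P. eventually P p \<longrightarrow> pws (int ` {x. P x})}"

lemma pws_UNIV_nat: "pws (int ` UNIV)"
  unfolding pws_def
proof (rule exI[of _ 0], rule allI)
  fix L :: int
  show "\<exists>u\<ge>L. \<forall>x\<in>{u..u + L}. \<exists>y\<in>range int. x \<le> y \<and> y \<le> x + 0"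
  proof (intro exI[of _ "max L 0"] conjI ballI)
    fix x assume "x \<in> {max L 0..max L 0 + L}"
    then have "x \<in> range int" by (intro range_eqI[of _ _ "nat x"]) auto
    then show "\<exists>y\<in>range int. x \<le> y \<and> y \<le> x + 0" by auto
  qed simp
qed

text \<open>By \<open>pws_Un\<close>, the sets whose complement is not piecewise syndetic form a
  filter; an ultrafilter below it has only piecewise syndetic members.\<close>

lemma pws_ultrafilters_nonempty: "pws_ultrafilters \<noteq> {}"
proof -
  define F where "F = Abs_filter (\<lambda>P. \<not> pws (int ` {x. \<not> P x}))"
  have filt: "is_filter (\<lambda>P. \<not> pws (int ` {x. \<not> P x}))"
  proof
    show "\<not> pws (int ` {x. \<not> True})" using not_pws_empty by simp
  next
    fix P Q :: "nat \<Rightarrow> bool"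
    assume "\<not> pws (int ` {x. \<not> P x})" "\<not> pws (int ` {x. \<not> Q x})"
    moreover have "int ` {x. \<not> (P x \<and> Q x)} = int ` {x. \<not> P x} \<union> int ` {x. \<not> Q x}" by auto
    ultimately show "\<not> pws (int ` {x. \<not> (P x \<and> Q x)})" using pws_Un by metis
  next
    fix P Q :: "nat \<Rightarrow> bool"
    assume *: "\<forall>x. P x \<longrightarrow> Q x" "\<not> pws (int ` {x. \<not> P x})"
    have "int ` {x. \<not> Q x} \<subseteq> int ` {x. \<not> P x}" using *(1) by auto
    with *(2) show "\<not> pws (int ` {x. \<not> Q x})" using pws_mono by blast
  qed
  have ev: "eventually P F \<longleftrightarrow> \<not> pws (int ` {x. \<not> P x})" for P
    unfolding F_def by (rule eventually_Abs_filter[OF filt])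
  have "F \<noteq> bot" using pws_UNIV_nat by (simp add: trivial_limit_def ev)
  then obtain p where p: "p \<le> F" "ultrafilter p" using ultrafilter_below by blast
  have "eventually (\<lambda>x. x > 0) F"
    unfolding ev by (rule not_pws_bounded[of _ 1]) auto
  then have "p \<in> betaN" using p by (auto simp: betaN_def le_filter_def)
  moreover have "pws (int ` {x. P x})" if "eventually P p" for P
  proof (rule ccontr)
    assume "\<not> pws (int ` {x. P x})"
    then have "eventually (\<lambda>x. \<not> P x) F" by (simp add: ev)
    then have "eventually (\<lambda>x. \<not> P x) p" using p by (auto simp: le_filter_def)
    with that have "eventually (\<lambda>x. False) p" by eventually_elim simp
    then show False using p(2) by (simp add: ultrafilter_def trivial_limit_def)
  qed
  ultimately show ?thesis by (auto simp: pws_ultrafilters_def)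
qed

text \<open>Each witnessing interval involves only finitely many points of \<open>S\<close>, and
  translating these by a natural number moves the interval to the right, hence still far enough
  out.\<close>

lemma pws_of_finite_translates:
  assumes S: "pws (int ` S)"
    and tr: "\<And>F. finite F \<Longrightarrow> F \<subseteq> S \<Longrightarrow> \<exists>y. \<forall>x\<in>F. x + y \<in> B"
  shows "pws (int ` B)"
proof -
  obtain m where m: "\<And>L. \<exists>u\<ge>L. \<forall>x\<in>{u..u + L}. \<exists>y\<in>int ` S. x \<le> y \<and> y \<le> x + m"
    using S unfolding pws_def by blast
  show ?thesis
    unfolding pws_def
  proof (rule exI[of _ m], rule allI)
    fix L
    obtain u where u: "u \<ge> L" and um: "\<And>x. x \<in> {u..u + L} \<Longrightarrow> \<exists>y\<in>int ` S. x \<le> y \<and> y \<le> x + m"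
      using m[of L] by blast
    define F where "F = S \<inter> {..nat (u + L + m)}"
    obtain w where w: "\<And>x. x \<in> F \<Longrightarrow> x + w \<in> B" using tr[of F] by (auto simp: F_def)
    show "\<exists>u\<ge>L. \<forall>x\<in>{u..u + L}. \<exists>y\<in>int ` B. x \<le> y \<and> y \<le> x + m"
    proof (intro exI[of _ "u + int w"] conjI ballI)
      show "L \<le> u + int w" using u by simp
      fix x assume "x \<in> {u + int w..u + int w + L}"
      then have x: "x - int w \<in> {u..u + L}" by auto
      then obtain s where s: "s \<in> S" "x - int w \<le> int s" "int s \<le> x - int w + m" using um by blast
      with x have "s \<in> F" by (auto simp: F_def)
      from w[OF this] have "int (s + w) \<in> int ` B" by (rule imageI)
      then show "\<exists>y\<in>int ` B. x \<le> y \<and> y \<le> x + m"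
        using s by (intro bexI[of _ "int (s + w)"]) auto
    qed
  qed
qed

text \<open>A member of \<open>p +\<^sub>\<beta> u\<close> has a translate in \<open>u\<close>. For
  a member of \<open>u +\<^sub>\<beta> p\<close>, finitely many of its translates in
  \<open>p\<close> have a common point, which puts a shifted copy of any finite part of a piecewise
  syndetic set into it.\<close>

lemma two_sided_ideal_pws_ultrafilters: "two_sided_ideal pws_ultrafilters"
  unfolding two_sided_ideal_def
proof (intro conjI ballI)
  show "pws_ultrafilters \<noteq> {}" by (rule pws_ultrafilters_nonempty)
  show "pws_ultrafilters \<subseteq> betaN" by (auto simp: pws_ultrafilters_def)
  fix u p assume u: "u \<in> pws_ultrafilters" and p: "p \<in> betaN"
  have uN: "u \<in> betaN" using u by (simp add: pws_ultrafilters_def)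
  have nb: "p \<noteq> bot" using p by (auto simp: betaN_def ultrafilter_def)
  show "p +\<^sub>\<beta> u \<in> pws_ultrafilters"
    unfolding pws_ultrafilters_def
  proof (intro CollectI conjI allI impI)
    show "p +\<^sub>\<beta> u \<in> betaN" using p uN by (rule beta_add_in_betaN)
    fix P assume "eventually P (p +\<^sub>\<beta> u)"
    then have "eventually (\<lambda>x. eventually (\<lambda>y. P (x + y)) u) p" by (simp add: eventually_beta_add)
    then obtain x where "eventually (\<lambda>y. P (x + y)) u"
      using eventually_happens'[OF nb] by blast
    then have "pws (int ` {y. P (x + y)})" using u by (simp add: pws_ultrafilters_def)
    moreover have "int ` {y. P (x + y)} \<subseteq> (\<lambda>y. y + int x) -` int ` {y. P y}"
    proof
      fix z assume "z \<in> int ` {y. P (x + y)}"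
      then obtain y where "P (x + y)" "z + int x = int (x + y)" by auto
      then show "z \<in> (\<lambda>y. y + int x) -` int ` {y. P y}" by blast
    qed
    ultimately show "pws (int ` {x. P x})" using pws_mono pws_shift by blast
  qed
  show "u +\<^sub>\<beta> p \<in> pws_ultrafilters"
    unfolding pws_ultrafilters_def
  proof (intro CollectI conjI allI impI)
    show "u +\<^sub>\<beta> p \<in> betaN" using uN p by (rule beta_add_in_betaN)
    fix P assume "eventually P (u +\<^sub>\<beta> p)"
    then have S: "pws (int ` {x. eventually (\<lambda>y. P (x + y)) p})"
      using u by (simp add: eventually_beta_add pws_ultrafilters_def)
    show "pws (int ` {x. P x})"
    proof (rule pws_of_finite_translates[OF S])
      fix F assume F: "finite F" "F \<subseteq> {x. eventually (\<lambda>y. P (x + y)) p}"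
      then have "eventually (\<lambda>y. \<forall>x\<in>F. P (x + y)) p"
        by (auto simp: eventually_ball_finite_distrib)
      then show "\<exists>y. \<forall>x\<in>F. x + y \<in> {x. P x}"
        using eventually_happens'[OF nb] by auto
    qed
  qed
qed

lemma pws_of_K_betaN:
  assumes "p \<in> K_betaN" "eventually P p"
  shows "pws (int ` {x. P x})"
proof -
  have "p \<in> pws_ultrafilters"
    using assms(1) two_sided_ideal_pws_ultrafilters unfolding K_betaN_def by blast
  then show ?thesis using assms(2) by (simp add: pws_ultrafilters_def)
qed

section \<open>Uniform recurrence along \<open>IP\<^sub>N\<close> sets\<close>

lemma sum_fun_apply: "(\<Sum>i\<in>I. f i) x = (\<Sum>i\<in>I. f i x)"
  for f :: "'i \<Rightarrow> 'a \<Rightarrow> 'b::comm_monoid_add"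
  by (induction I rule: infinite_finite_induct) auto

text \<open>The cross terms of the binomial expansion are monomials of degree \<open>1\<close> to
  \<open>k - 1\<close>. Their coefficients involve \<open>D \<beta>\<close>, which is why
  \<open>c\<close> may depend on \<beta>.\<close>

lemma polymap_monomial:
  fixes c :: "'i \<Rightarrow> int"
  assumes "k \<ge> 1"
  shows "polymap k (\<lambda>v \<beta>. c \<beta> * v \<beta> ^ k)"
  using assms
proof (induction k arbitrary: c rule: less_induct)
  case (less k)
  then obtain d where k: "k = Suc d" by (cases k) auto
  define \<phi> where "\<phi> = (\<lambda>v \<beta>. c \<beta> * v \<beta> ^ k)"
  have "\<phi> 0 = 0" by (simp add: \<phi>_def k zero_fun_def)
  moreover have "polymap d (\<lambda>x. \<phi> (x + D) - \<phi> x - \<phi> D)" for D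
  proof -
    define e where "e = (\<lambda>j \<beta>. c \<beta> * of_nat (k choose j) * D \<beta> ^ (k - j))"
    have "\<phi> (x + D) - \<phi> x - \<phi> D = (\<Sum>j\<in>{1..<k}. (\<lambda>\<beta>. e j \<beta> * x \<beta> ^ j))" for x
    proof
      fix \<beta>
      have split: "{..k} = insert 0 (insert k {1..<k})" using k by auto
      have "(x \<beta> + D \<beta>) ^ k = x \<beta> ^ k + D \<beta> ^ k +
          (\<Sum>j\<in>{1..<k}. of_nat (k choose j) * x \<beta> ^ j * D \<beta> ^ (k - j))"
        unfolding binomial_ring split using k by simp
      then show "(\<phi> (x + D) - \<phi> x - \<phi> D) \<beta> = (\<Sum>j\<in>{1..<k}. (\<lambda>\<beta>. e j \<beta> * x \<beta> ^ j)) \<beta>"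
        by (simp add: \<phi>_def e_def sum_fun_apply sum_distrib_left algebra_simps)
    qed
    moreover have "polymap d (\<lambda>x. \<Sum>j\<in>{1..<k}. (\<lambda>\<beta>. e j \<beta> * x \<beta> ^ j))"
    proof (rule polymap_sum)
      fix j assume "j \<in> {1..<k}"
      then show "polymap d (\<lambda>x \<beta>. e j \<beta> * x \<beta> ^ j)"
        using k by (intro polymap_mono[OF less.IH]) auto
    qed
    ultimately show ?thesis by (simp only:)
  qed
  ultimately have "polymap (Suc d) \<phi>" by (simp only: polymap.simps simp_thms)
  then show ?case unfolding k[symmetric] \<phi>_def .
qed

lemma polymap_poly:
  assumes "P \<in> int_polys0"
  shows "polymap (degree P) (\<lambda>v (\<beta>::'i). poly P (v \<beta>))"
proof -
  have "polymap (degree P) (\<lambda>v (\<beta>::'i). coeff P i * v \<beta> ^ i)" if "i \<in> {..degree P}" for i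
  proof (cases "i = 0")
    case True
    then have "(\<lambda>v (\<beta>::'i). coeff P i * v \<beta> ^ i) = (\<lambda>v. 0)"
      using assms by (simp add: int_polys0_def zero_fun_def)
    then show ?thesis by (simp only: polymap_zero)
  next
    case False
    then show ?thesis using that polymap_mono[OF polymap_monomial[of i "\<lambda>_. coeff P i"]] by simp
  qed
  then have "polymap (degree P) (\<lambda>v. \<Sum>i\<in>{..degree P}. (\<lambda>(\<beta>::'i). coeff P i * v \<beta> ^ i))"
    by (rule polymap_sum)
  moreover have "(\<Sum>i\<in>{..degree P}. (\<lambda>(\<beta>::'i). coeff P i * v \<beta> ^ i)) = (\<lambda>\<beta>. poly P (v \<beta>))" for v
    by (rule ext) (simp add: sum_fun_apply poly_altdef)
  ultimately show ?thesis by (simp only:)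
qed

text \<open>Every \<open>x\<close> in a long interval where \<open>B\<close> has bounded gaps
  induces a colouring of the window \<open>M\<close>, and a monochromatic translate gives a point
  near \<open>x\<close> that works for some \<open>H\<close>. There are finitely many
  \<open>H\<close>, so partition regularity selects a single one.\<close>

lemma pws_polynomial_recurrence:
  assumes B: "pws B" and F: "finite F" "F \<subseteq> int_polys0"
  shows "\<exists>N\<ge>1. \<forall>b::nat \<Rightarrow> int. \<exists>H. H \<noteq> {} \<and> H \<subseteq> {1..N} \<and>
    pws {x. \<forall>P\<in>F. x + poly P (\<Sum>t\<in>H. b t) \<in> B}"
proof -
  obtain m where m0: "m \<ge> 0" and m: "\<And>L. \<exists>u\<ge>L. \<forall>x\<in>{u..u + L}. \<exists>y\<in>B. x \<le> y \<and> y \<le> x + m"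
    using pwsE[OF B] by blast
  \<comment> \<open>Evaluation at \<open>\<beta>\<close> turns the universal generators \<open>X i\<close> into any given integers \<open>\<beta> i\<close>.\<close>
  define X :: "nat \<Rightarrow> (nat \<Rightarrow> int) \<Rightarrow> int" where "X = (\<lambda>i \<beta>. \<beta> i)"
  define \<phi> where "\<phi> = (\<lambda>P (v::(nat \<Rightarrow> int) \<Rightarrow> int) \<beta>. poly P (v \<beta>))"
  have "vdW X (\<phi> ` F)"
  proof (rule polymap_vdW)
    fix \<psi> assume "\<psi> \<in> \<phi> ` F"
    then show "\<exists>d. polymap d \<psi>" using polymap_poly F unfolding \<phi>_def by blast
  qed (use F in simp)
  then obtain N M where M: "finite M"
    and NM: "\<And>\<chi>. (\<forall>x. \<chi> x < Suc (nat m)) \<Longrightarrow> mono_translate X (\<phi> ` F) 1 N M \<chi>"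
    unfolding vdW_def by metis
  show ?thesis
  proof (rule exI[of _ "max 1 N"], intro conjI allI)
    fix \<beta> :: "nat \<Rightarrow> int"
    define C where "C = (\<lambda>H. {x. \<forall>P\<in>F. x + poly P (\<Sum>t\<in>H. \<beta> t) \<in> B})"
    define I where "I = {H. H \<noteq> {} \<and> H \<subseteq> {1..max 1 N}}"
    \<comment> \<open>\<open>K\<close> bounds the window elements evaluated at \<beta>, so
      \<open>x + K + g \<beta>\<close> stays between \<open>x\<close> and
      \<open>x + 2 * K\<close>.\<close>
    define K where "K = (\<Sum>g\<in>M. \<bar>g \<beta>\<bar>)"
    have K: "\<bar>g \<beta>\<bar> \<le> K" if "g \<in> M" for g
      unfolding K_def using M that by (intro member_le_sum) auto
    have K0: "K \<ge> 0" unfolding K_def by (intro sum_nonneg) simp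
    have "pws (\<Union>H\<in>I. C H)"
      unfolding pws_def
    proof (rule exI[of _ "2 * K + m"], rule allI)
      fix L0 :: int
      define L where "L = max L0 0 + 2 * K"
      obtain u where u: "u \<ge> L" and um: "\<And>x. x \<in> {u..u + L} \<Longrightarrow> \<exists>y\<in>B. x \<le> y \<and> y \<le> x + m"
        using m[of L] by blast
      show "\<exists>u\<ge>L0. \<forall>x\<in>{u..u + L0}. \<exists>y\<in>\<Union>H\<in>I. C H. x \<le> y \<and> y \<le> x + (2 * K + m)"
      proof (rule exI[of _ u], intro conjI ballI)
        show "L0 \<le> u" using u K0 by (simp add: L_def)
        fix x assume x: "x \<in> {u..u + L0}"
        \<comment> \<open>\<open>g\<close> is coloured by a distance at which \<open>B\<close> occurs to the right of the centre \<open>x + K\<close> shifted by \<open>g \<beta>\<close>.\<close>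
        define hit where "hit = (\<lambda>g (j::nat). j \<le> nat m \<and> x + K + g \<beta> + int j \<in> B)"
        \<comment> \<open>The default \<open>0\<close> concerns only \<open>g\<close> without a hit;
          \<open>hitM\<close> shows that none of these lies in \<open>M\<close>.\<close>
        define \<chi> where "\<chi> = (\<lambda>g. if \<exists>j. hit g j then SOME j. hit g j else 0)"
        have hit: "hit g (\<chi> g)" if "\<exists>j. hit g j" for g
          using someI_ex[OF that] that by (simp add: \<chi>_def)
        have "\<chi> g < Suc (nat m)" for g
          using hit[of g] by (cases "\<exists>j. hit g j") (auto simp: \<chi>_def hit_def)
        then have "mono_translate X (\<phi> ` F) 1 N M \<chi>" by (intro NM) simp
        then obtain a H where a: "a \<in> M" and H: "H \<noteq> {}" "H \<subseteq> {1..<N}"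
          and mono: "\<forall>\<psi>\<in>\<phi> ` F. a + \<psi> (sum X H) \<in> M \<and> \<chi> (a + \<psi> (sum X H)) = \<chi> a"
          unfolding mono_translate_def by (elim bexE exE conjE)
        have hitM: "hit g (\<chi> g)" if g: "g \<in> M" for g
        proof (rule hit)
          have "x + K + g \<beta> \<in> {u..u + L}" using x K[OF g] by (auto simp: L_def)
          from um[OF this] obtain y where y: "y \<in> B" "x + K + g \<beta> \<le> y" "y \<le> x + K + g \<beta> + m"
            by blast
          then have "hit g (nat (y - (x + K + g \<beta>)))" by (auto simp: hit_def)
          then show "\<exists>j. hit g j" ..
        qed
        define y where "y = x + K + a \<beta> + int (\<chi> a)"
        have "y \<in> C H"
          unfolding C_def
        proof (intro CollectI ballI)
          fix P assume P: "P \<in> F"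
          have val: "(a + \<phi> P (sum X H)) \<beta> = a \<beta> + poly P (\<Sum>t\<in>H. \<beta> t)"
            by (simp add: \<phi>_def X_def sum_fun_apply)
          have "a + \<phi> P (sum X H) \<in> M" and col: "\<chi> (a + \<phi> P (sum X H)) = \<chi> a"
            using mono P by auto
          from hitM[OF this(1)] have "x + K + (a + \<phi> P (sum X H)) \<beta> + int (\<chi> a) \<in> B"
            unfolding col by (simp only: hit_def)
          then show "y + poly P (\<Sum>t\<in>H. \<beta> t) \<in> B"
            unfolding val y_def by (simp add: algebra_simps)
        qed
        moreover have "H \<in> I" using H by (force simp: I_def)
        moreover have "int (\<chi> a) \<le> m" using hitM[OF a] m0 by (simp add: hit_def le_nat_iff)
        then have "x \<le> y" "y \<le> x + (2 * K + m)" using K[OF a] by (auto simp: y_def)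
        ultimately show "\<exists>y\<in>\<Union>H\<in>I. C H. x \<le> y \<and> y \<le> x + (2 * K + m)" by blast
      qed
    qed
    moreover have "finite I"
      by (rule finite_subset[of _ "Pow {1..max 1 N}"]) (auto simp: I_def)
    ultimately obtain H where "H \<in> I" "pws (C H)" using pws_UN by blast
    then show "\<exists>H. H \<noteq> {} \<and> H \<subseteq> {1..max 1 N} \<and>
        pws {x. \<forall>P\<in>F. x + poly P (\<Sum>t\<in>H. \<beta> t) \<in> B}"
      by (auto simp: I_def C_def)
  qed simp
qed

text \<open>Keeps the set of realised exponents finite at every stage of the construction.\<close>

lemma finite_poly_class: "finite (poly_class f m x)"
proof -
  define d where "d = f m x"
  define S where "S = poly_class f m x"
  have deg: "degree P \<le> d" if "P \<in> S" for P
    using that by (simp add: S_def poly_class_def d_def)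
  have bound: "\<bar>coeff P i\<bar> \<le> int d" if "P \<in> S" for P i
  proof (cases "i \<le> degree P")
    case True
    then have "\<bar>coeff P i\<bar> \<le> max_coef P" unfolding max_coef_def by (intro Max_ge) auto
    then show ?thesis using that by (simp add: S_def poly_class_def d_def)
  qed (simp add: coeff_eq_0)
  let ?g = "\<lambda>P::int poly. map (coeff P) [0..<Suc d]"
  have "inj_on ?g S"
  proof (rule inj_onI, rule poly_eqI)
    fix P Q i assume PQ: "P \<in> S" "Q \<in> S" "?g P = ?g Q"
    show "coeff P i = coeff Q i"
    proof (cases "i \<le> d")
      case True
      from PQ(3) have "?g P ! i = ?g Q ! i" by (rule arg_cong)
      then show ?thesis using True by (simp only: length_upt nth_map nth_upt) simp
    next
      case False
      then show ?thesis using deg[OF PQ(1)] deg[OF PQ(2)] by (simp add: coeff_eq_0)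
    qed
  qed
  moreover have "?g ` S \<subseteq> {xs. set xs \<subseteq> {- int d..int d} \<and> length xs = Suc d}"
    using bound by (auto simp: abs_le_iff minus_le_iff simp del: upt_Suc)
  then have "finite (?g ` S)"
    by (rule finite_subset) (intro finite_lists_length_eq, simp)
  ultimately show ?thesis unfolding S_def by (rule finite_imageD[rotated])
qed

section \<open>The greedy construction\<close>

definition common_shifts :: "nat set \<Rightarrow> int set \<Rightarrow> int set" where
  "common_shifts T S = {a. \<forall>s\<in>S. a + s \<in> int ` T}"

lemma next_term:
  fixes n :: nat
  assumes n: "n > 0" and q: "q \<in> betaN"
    and IP: "\<forall>N\<ge>1. \<forall>B. (\<forall>\<^sub>F x in q. x \<in> B) \<longrightarrow> (\<exists>S. IP_set N S \<and> S \<subseteq> B)"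
    and T: "T = {a. \<forall>\<^sub>F b in q. n ^ a * b \<in> A}"
    and S: "finite S" "pws (common_shifts T S)"
    and F: "finite F" "F \<subseteq> int_polys0"
  shows "\<exists>x\<ge>1. (\<forall>s\<in>S. rat_of_nat x * rat_of_nat n powi s \<in> rat_of_nat ` A) \<and>
     pws (common_shifts T {s + poly P (int x) | s P. s \<in> S \<and> P \<in> F})"
proof -
  obtain a0 where a0: "a0 \<in> common_shifts T S" "a0 \<ge> 0" using pws_nonneg[OF S(2)] by blast
  define a where "a = nat a0"
  have aT: "nat (int a + s) \<in> T" and as: "int a + s \<ge> 0" if "s \<in> S" for s
    using a0 that by (auto simp: common_shifts_def a_def)
  define G where "G = {b. b > 0 \<and> (\<forall>s\<in>S. n ^ nat (int a + s) * b \<in> A)}"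
  have "\<forall>\<^sub>F b in q. b \<in> G"
  proof -
    have "\<forall>\<^sub>F b in q. \<forall>s\<in>S. n ^ nat (int a + s) * b \<in> A"
      using aT S(1) by (auto simp: T eventually_ball_finite_distrib)
    moreover have "\<forall>\<^sub>F b in q. b > 0" using q by (simp add: betaN_def)
    ultimately show ?thesis by eventually_elim (simp add: G_def)
  qed
  \<comment> \<open>Recurrence is applied to the sum \<open>c\<close> of generators, whereas the
    next term is \<open>n ^ a * c\<close>; composing with the scaling by \<open>n ^ a\<close>
    accounts for this.\<close>
  define F' where "F' = (\<lambda>P. pcompose P [:0, int n ^ a:]) ` F"
  have "finite F'" "F' \<subseteq> int_polys0"
    using F by (auto simp: F'_def int_polys0_def poly_0_coeff_0[symmetric] poly_pcompose)
  from pws_polynomial_recurrence[OF S(2) this] obtain N where N: "N \<ge> 1"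
    and rec: "\<And>b::nat \<Rightarrow> int. \<exists>H. H \<noteq> {} \<and> H \<subseteq> {1..N} \<and>
      pws {x. \<forall>P\<in>F'. x + poly P (\<Sum>t\<in>H. b t) \<in> common_shifts T S}" by blast
  from IP N \<open>\<forall>\<^sub>F b in q. b \<in> G\<close> obtain Z where Z: "IP_set N Z" "Z \<subseteq> G" by blast
  then obtain b where Zb: "Z = {\<Sum>t\<in>H. b t | H. H \<noteq> {} \<and> H \<subseteq> {1..N}}"
    unfolding IP_set_def by blast
  obtain H where H: "H \<noteq> {}" "H \<subseteq> {1..N}"
    and pH: "pws {x. \<forall>P\<in>F'. x + poly P (\<Sum>t\<in>H. int (b t)) \<in> common_shifts T S}"
    using rec[of "\<lambda>t. int (b t)"] by blast
  define c where "c = (\<Sum>t\<in>H. b t)"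
  have "c \<in> Z" using H by (auto simp: Zb c_def)
  then have c: "c \<in> G" using Z(2) by blast
  define x where "x = n ^ a * c"
  show ?thesis
  proof (intro exI[of _ x] conjI ballI)
    show "x \<ge> 1" using n c by (simp add: x_def G_def Suc_le_eq)
    fix s assume s: "s \<in> S"
    have "rat_of_nat n ^ a * rat_of_nat n powi s = rat_of_nat n powi (int a + s)"
      using n by (simp add: power_int_add)
    also have "\<dots> = rat_of_nat n ^ nat (int a + s)"
      using as[OF s] by (simp add: power_int_def)
    finally have "rat_of_nat x * rat_of_nat n powi s = rat_of_nat (n ^ nat (int a + s) * c)"
      by (simp add: x_def)
    then show "rat_of_nat x * rat_of_nat n powi s \<in> rat_of_nat ` A"
      using c s unfolding G_def by blast
  next
    have "poly (pcompose P [:0, int n ^ a:]) (\<Sum>t\<in>H. int (b t)) = poly P (int x)" for P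
      by (simp add: poly_pcompose x_def c_def mult.commute)
    then have "{x. \<forall>P\<in>F'. x + poly P (\<Sum>t\<in>H. int (b t)) \<in> common_shifts T S} \<subseteq>
        common_shifts T {s + poly P (int x) | s P. s \<in> S \<and> P \<in> F}"
      by (auto simp: F'_def common_shifts_def add.assoc add.left_commute add.commute)
    with pH show "pws (common_shifts T {s + poly P (int x) | s P. s \<in> S \<and> P \<in> F})"
      using pws_mono by blast
  qed
qed

theorem theorem1p9:
  fixes n :: nat and p q :: "nat filter" and A :: "nat set"
    and F1 :: "int poly set" and f :: "nat \<Rightarrow> nat \<Rightarrow> nat"
  assumes "n > 1"
    and "p \<in> idempotents K_betaN"
    and "q \<in> betaN"
    and "\<forall>N\<ge>1. \<forall>B. (\<forall>\<^sub>F x in q. x \<in> B) \<longrightarrow> (\<exists>S. IP_set N S \<and> S \<subseteq> B)"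
    and "A \<subseteq> {1..}" and "\<forall>\<^sub>F x in star n p q. x \<in> A"
    and "finite F1" and "F1 \<noteq> {}" and "F1 \<subseteq> int_polys0"
    and "\<forall>m\<ge>2. \<forall>x\<ge>1. f m x \<ge> 1"
  shows "\<exists>x :: nat \<Rightarrow> nat. (\<forall>k\<ge>1. x k \<ge> 1) \<and>
    {rat_of_nat (x k) * rat_of_nat n powi (\<Sum>i = 1..k - 1. poly (P i) (int (x i))) | k P.
       k \<ge> 1 \<and> P 1 \<in> F1 \<and> (\<forall>i\<in>{2..k - 1}. P i \<in> poly_class f i (f i (x (i - 1))))}
    \<subseteq> rat_of_nat ` A"
proof -
  define T where "T = {a. \<forall>\<^sub>F b in q. n ^ a * b \<in> A}"
  define FF where "FF = (\<lambda>k x. if k = 1 then F1 else poly_class f k (f k x))"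
  have FF: "finite (FF k x)" "FF k x \<subseteq> int_polys0" for k x
    using assms(7,9) finite_poly_class by (auto simp: FF_def poly_class_def)
  \<comment> \<open>A state consists of the exponents available to the next term and the latest
    term. The clause for \<open>k = 0\<close> records the empty sum as initial exponent, since the
    choice principle only retains \<open>good\<close>.\<close>
  define good :: "nat \<Rightarrow> int set \<times> nat \<Rightarrow> bool" where
    "good = (\<lambda>k (S, x). finite S \<and> pws (common_shifts T S) \<and> (k = 0 \<longrightarrow> S = {0}))"
  define step :: "nat \<Rightarrow> int set \<times> nat \<Rightarrow> int set \<times> nat \<Rightarrow> bool" where
    "step = (\<lambda>k (S, x) (S', x'). x' \<ge> 1 \<and>
       (\<forall>s\<in>S. rat_of_nat x' * rat_of_nat n powi s \<in> rat_of_nat ` A) \<and>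
       S' = {s + poly P (int x') | s P. s \<in> S \<and> P \<in> FF (Suc k) x})"
  have "\<exists>st. \<forall>k. good k (st k) \<and> step k (st k) (st (Suc k))"
  proof (rule dependent_nat_choice)
    have "\<forall>\<^sub>F a in p. a \<in> T" using assms(6) by (simp add: eventually_star T_def)
    then have "pws (int ` T)"
      using pws_of_K_betaN[of p "\<lambda>a. a \<in> T"] assms(2) by (simp add: idempotents_def)
    then have "good 0 ({0}, 0)" by (simp add: good_def common_shifts_def)
    then show "\<exists>z. good 0 z" ..
  next
    fix z k assume z: "good k z"
    obtain S x where z_eq: "z = (S, x)" by (cases z)
    have S: "finite S" "pws (common_shifts T S)" using z by (auto simp: good_def z_eq)
    have "n > 0" using assms(1) by simp
    from next_term[OF this assms(3,4) T_def S FF, of "Suc k" x] obtain x' where x': "x' \<ge> 1"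
      "\<forall>s\<in>S. rat_of_nat x' * rat_of_nat n powi s \<in> rat_of_nat ` A"
      "pws (common_shifts T {s + poly P (int x') | s P. s \<in> S \<and> P \<in> FF (Suc k) x})" by blast
    have "finite ((\<lambda>(s, P). s + poly P (int x')) ` (S \<times> FF (Suc k) x))"
      using S FF by blast
    moreover have "(\<lambda>(s, P). s + poly P (int x')) ` (S \<times> FF (Suc k) x) =
        {s + poly P (int x') | s P. s \<in> S \<and> P \<in> FF (Suc k) x}" by auto
    ultimately show "\<exists>w. good (Suc k) w \<and> step k z w"
      using x' by (intro exI[of _ "({s + poly P (int x') | s P. s \<in> S \<and> P \<in> FF (Suc k) x}, x')"])
        (simp add: good_def step_def z_eq)
  qed
  then obtain st where good: "\<And>k. good k (st k)" and step: "\<And>k. step k (st k) (st (Suc k))"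
    by blast
  define S where "S = (\<lambda>k. fst (st k))"
  define x where "x = (\<lambda>k. snd (st k))"
  have S0: "S 0 = {0}" using good[of 0] by (auto simp: good_def S_def)
  have x: "x (Suc k) \<ge> 1"
    "s \<in> S k \<Longrightarrow> rat_of_nat (x (Suc k)) * rat_of_nat n powi s \<in> rat_of_nat ` A"
    "S (Suc k) = {s + poly P (int (x (Suc k))) | s P. s \<in> S k \<and> P \<in> FF (Suc k) (x k)}" for k s
    using step[of k] by (auto simp: step_def S_def x_def case_prod_unfold)
  \<comment> \<open>The index is offset by one: \<open>S k\<close> contains the exponents used with
    \<open>x (Suc k)\<close>.\<close>
  have mem: "(\<Sum>i = 1..k. poly (P i) (int (x i))) \<in> S k"
    if "P 1 \<in> F1" "\<forall>i\<in>{2..k}. P i \<in> poly_class f i (f i (x (i - 1)))" for k P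
    using that(2)
  proof (induction k)
    case 0
    then show ?case by (simp add: S0)
  next
    case (Suc k)
    have "P (Suc k) \<in> FF (Suc k) (x k)"
      using that(1) bspec[OF Suc.prems, of "Suc k"] by (cases "k = 0") (auto simp: FF_def)
    moreover have "(\<Sum>i = 1..k. poly (P i) (int (x i))) \<in> S k" using Suc by simp
    ultimately show ?case unfolding x(3) by force
  qed
  show ?thesis
  proof (intro exI[of _ x] conjI allI impI subsetI)
    fix k :: nat assume "k \<ge> 1"
    then show "x k \<ge> 1" using x(1)[of "k - 1"] by simp
  next
    fix r assume "r \<in> {rat_of_nat (x k) * rat_of_nat n powi (\<Sum>i = 1..k - 1. poly (P i) (int (x i))) | k P.
       k \<ge> 1 \<and> P 1 \<in> F1 \<and> (\<forall>i\<in>{2..k - 1}. P i \<in> poly_class f i (f i (x (i - 1))))}"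
    then obtain k P where r: "r = rat_of_nat (x k) * rat_of_nat n powi (\<Sum>i = 1..k - 1. poly (P i) (int (x i)))"
      and k: "k \<ge> 1" and P: "P 1 \<in> F1" "\<forall>i\<in>{2..k - 1}. P i \<in> poly_class f i (f i (x (i - 1)))"
      by blast
    from x(2)[OF mem[OF P]] show "r \<in> rat_of_nat ` A" using k by (simp add: r)
  qed
qed

end
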